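(* Let $G=(V,E)$ be a graph (not necessarily bipartite) in which every node has a strict preference order over its neighbours, and let $M$ be a matching in $G$. Then $M$ is strongly dominant in $G$ if and only if there exists $\vec\alpha\in\mathbb{R}^V$ with $\sum_{u\in V}\alpha_u=0$, $\alpha_u+\alpha_v\ge\mathsf{wt}_M(u,v)$ for every $(u,v)\in E$, $\alpha_u\ge\mathsf{wt}_M(u,u)$ for every $u\in V$, and moreover $\alpha_u\in\{1,-1\}$ for every node $u$ matched in $M$ and $\alpha_u=0$ for every node $u$ unmatched in $M$.
   Context: $M(u)$ is the partner of $u$ in $M$; an unmatched node prefers any neighbour to being unmatched. For $(u,v)\in E\setminus M$, the label of $(u,v)$ at $u$ is $+$ if $u$ is unmatched in $M$ or prefers $v$ to $M(u)$, and $-$ otherwise; $(u,v)$ is a $(+,+)$ edge if both labels are $+$ and a $(-,-)$ edge if both are $-$. Define $\mathsf{wt}_M(u,v)=2$ if $(u,v)$ is $(+,+)$, $-2$ if $(u,v)$ is $(-,-)$, and $0$ otherwise (in particular for edges of $M$); $\mathsf{wt}_M(u,u)=0$ if $u$ is unmatched in $M$ and $-1$ otherwise. A matching $M$ is strongly dominant in $G$ if there is a partition $(L,R)$ of $V$ such that (i) every edge of $M$ has one endpoint in $L$ and the other in $R$, (ii) every node of $R$ is matched in $M$, (iii) every $(+,+)$ edge has both endpoints in $R$, and (iv) every edge of $G$ with both endpoints in $L$ is a $(-,-)$ edge. *)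

theory Defs
  imports Complex_Main
begin

definition simple_graph :: "'a set \<Rightarrow> 'a set set \<Rightarrow> bool" where
  "simple_graph V E \<longleftrightarrow> finite V \<and> (\<forall>e\<in>E. e \<subseteq> V \<and> card e = 2)"

definition neighbours :: "'a set set \<Rightarrow> 'a \<Rightarrow> 'a set" where
  "neighbours E u = {v. {u, v} \<in> E}"

text \<open>\<open>(v, w) \<in> pref u\<close> means that \<open>u\<close> prefers \<open>v\<close> to \<open>w\<close>.\<close>

definition strict_prefs :: "'a set \<Rightarrow> 'a set set \<Rightarrow> ('a \<Rightarrow> 'a rel) \<Rightarrow> bool" where
  "strict_prefs V E pref \<longleftrightarrow>
     (\<forall>u\<in>V. pref u \<subseteq> neighbours E u \<times> neighbours E u \<and>
             strict_linear_order_on (neighbours E u) (pref u))"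

definition matching :: "'a set set \<Rightarrow> 'a set set \<Rightarrow> bool" where
  "matching E M \<longleftrightarrow> M \<subseteq> E \<and> pairwise disjnt M"

definition matched :: "'a set set \<Rightarrow> 'a \<Rightarrow> bool" where
  "matched M u \<longleftrightarrow> (\<exists>v. {u, v} \<in> M)"

definition partner :: "'a set set \<Rightarrow> 'a \<Rightarrow> 'a" where
  "partner M u = (THE v. {u, v} \<in> M)"

text \<open>The label of the edge \<open>{u, v}\<close> at \<open>u\<close> is \<open>+\<close>; only meaningful for edges outside \<open>M\<close>.\<close>

definition plus_label :: "('a \<Rightarrow> 'a rel) \<Rightarrow> 'a set set \<Rightarrow> 'a \<Rightarrow> 'a \<Rightarrow> bool" where
  "plus_label pref M u v \<longleftrightarrow> \<not> matched M u \<or> (v, partner M u) \<in> pref u"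

definition plus_plus_edge ::
  "'a set set \<Rightarrow> ('a \<Rightarrow> 'a rel) \<Rightarrow> 'a set set \<Rightarrow> 'a \<Rightarrow> 'a \<Rightarrow> bool" where
  "plus_plus_edge E pref M u v \<longleftrightarrow>
     {u, v} \<in> E - M \<and> plus_label pref M u v \<and> plus_label pref M v u"

definition minus_minus_edge ::
  "'a set set \<Rightarrow> ('a \<Rightarrow> 'a rel) \<Rightarrow> 'a set set \<Rightarrow> 'a \<Rightarrow> 'a \<Rightarrow> bool" where
  "minus_minus_edge E pref M u v \<longleftrightarrow>
     {u, v} \<in> E - M \<and> \<not> plus_label pref M u v \<and> \<not> plus_label pref M v u"

definition wt :: "'a set set \<Rightarrow> ('a \<Rightarrow> 'a rel) \<Rightarrow> 'a set set \<Rightarrow> 'a \<Rightarrow> 'a \<Rightarrow> real" where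
  "wt E pref M u v =
     (if u = v then (if matched M u then - 1 else 0)
      else if plus_plus_edge E pref M u v then 2
      else if minus_minus_edge E pref M u v then - 2
      else 0)"

text \<open>The parts of the partition \<open>(L, R)\<close> may be empty; for \<open>M = {}\<close> the part \<open>R\<close> has to be.\<close>

definition strongly_dominant ::
  "'a set \<Rightarrow> 'a set set \<Rightarrow> ('a \<Rightarrow> 'a rel) \<Rightarrow> 'a set set \<Rightarrow> bool" where
  "strongly_dominant V E pref M \<longleftrightarrow>
     (\<exists>L R. L \<union> R = V \<and> L \<inter> R = {} \<and>
        (\<forall>e\<in>M. \<exists>u\<in>L. \<exists>v\<in>R. e = {u, v}) \<and>
        (\<forall>u\<in>R. matched M u) \<and>
        (\<forall>u v. plus_plus_edge E pref M u v \<longrightarrow> u \<in> R \<and> v \<in> R) \<and>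
        (\<forall>u\<in>L. \<forall>v\<in>L. {u, v} \<in> E \<longrightarrow> minus_minus_edge E pref M u v))"

end

theory Submission
  imports Defs
begin

text \<open>
  A partition \<open>(L, R)\<close> corresponds to the vector with \<open>R = {u. \<alpha> u = 1}\<close>, matched nodes of \<open>L\<close>
  getting the value \<open>-1\<close>. Since \<open>\<alpha>\<close> vanishes on unmatched nodes, its total is the sum of
  \<open>\<alpha> u + \<alpha> v\<close> over the edges of \<open>M\<close>. These terms are all nonnegative, so a zero total makes each
  of them zero, that is, every edge of \<open>M\<close> joins a node of value \<open>1\<close> to a node of value \<open>-1\<close>.
\<close>

lemma simple_graph_edgeD:
  assumes "simple_graph V E" "{u, v} \<in> E"
  shows "u \<in> V" "v \<in> V" "u \<noteq> v"
proof -
  have "{u, v} \<subseteq> V" "card {u, v} = 2"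
    using assms unfolding simple_graph_def by blast+
  then show "u \<in> V" "v \<in> V" "u \<noteq> v" by auto
qed

lemma simple_graph_edgeE:
  assumes "simple_graph V E" "e \<in> E"
  obtains u v where "e = {u, v}" "u \<noteq> v"
proof -
  have "card e = 2" using assms unfolding simple_graph_def by blast
  then show thesis unfolding card_2_iff using that by blast
qed

text \<open>Identifies the set of matched nodes with \<open>\<Union>M\<close>, over which a sum can
  be split along the edges of \<open>M\<close>.\<close>

lemma matched_iff_Union:
  assumes "simple_graph V E" "matching E M"
  shows "matched M u \<longleftrightarrow> u \<in> \<Union>M"
proof
  assume "u \<in> \<Union>M"
  then obtain e where e: "e \<in> M" "u \<in> e" by blast
  with assms(2) have "e \<in> E" unfolding matching_def by blast
  then obtain a b where "e = {a, b}" by (rule simple_graph_edgeE[OF assms(1)])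
  with e show "matched M u"
    unfolding matched_def by (metis insert_commute insertE singletonD)
qed (auto simp: matched_def)

text \<open>Unmatched nodes contribute nothing, and the pairwise disjoint edges of \<open>M\<close>
  count each matched node exactly once. Both directions of the equivalence read the total of
  \<open>\<alpha>\<close> through this identity.\<close>

lemma sum_over_matching:
  fixes \<alpha> :: "'a \<Rightarrow> real"
  assumes "simple_graph V E" "matching E M"
    and "\<And>u. u \<in> V \<Longrightarrow> \<not> matched M u \<Longrightarrow> \<alpha> u = 0"
  shows "(\<Sum>u\<in>V. \<alpha> u) = (\<Sum>e\<in>M. \<Sum>u\<in>e. \<alpha> u)"
proof -
  have V: "finite V" "\<Union>M \<subseteq> V" and fin: "\<forall>e\<in>M. finite e"
    using assms(1,2) unfolding simple_graph_def matching_def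
    by (blast, blast, metis card.infinite subsetD zero_neq_numeral)
  have "(\<Sum>u\<in>V. \<alpha> u) = (\<Sum>u\<in>\<Union>M. \<alpha> u)"
    using V assms(3) matched_iff_Union[OF assms(1,2)] by (intro sum.mono_neutral_right) auto
  also have "\<dots> = (\<Sum>e\<in>M. \<Sum>u\<in>e. \<alpha> u)"
    using fin assms(2) unfolding matching_def pairwise_def disjnt_def
    by (subst sum.Union_disjoint) auto
  finally show ?thesis .
qed

text \<open>Edges of weight 2 or -2 lie in \<open>E - M\<close> by definition, and
  \<open>u \<noteq> v\<close> rules out the branch of \<open>wt\<close> meant for single
  nodes.\<close>

lemma wt_matching_edge: "{u, v} \<in> M \<Longrightarrow> u \<noteq> v \<Longrightarrow> wt E pref M u v = 0"
  by (simp add: wt_def plus_plus_edge_def minus_minus_edge_def)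

theorem theorem5:
  fixes V :: "'a set" and E M :: "'a set set" and pref :: "'a \<Rightarrow> 'a rel"
  assumes "simple_graph V E"
    and "strict_prefs V E pref"
    and "matching E M"
  shows "strongly_dominant V E pref M \<longleftrightarrow>
    (\<exists>\<alpha> :: 'a \<Rightarrow> real.
       (\<Sum>u\<in>V. \<alpha> u) = 0 \<and>
       (\<forall>u v. {u, v} \<in> E \<longrightarrow> \<alpha> u + \<alpha> v \<ge> wt E pref M u v) \<and>
       (\<forall>u\<in>V. \<alpha> u \<ge> wt E pref M u u) \<and>
       (\<forall>u\<in>V. matched M u \<longrightarrow> \<alpha> u \<in> {1, - 1}) \<and>
       (\<forall>u\<in>V. \<not> matched M u \<longrightarrow> \<alpha> u = 0))"
proof
  assume "strongly_dominant V E pref M"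
  then obtain L R where V: "L \<union> R = V" and disj: "L \<inter> R = {}"
    and M[rule_format]: "\<forall>e\<in>M. \<exists>u\<in>L. \<exists>v\<in>R. e = {u, v}"
    and R[rule_format]: "\<forall>u\<in>R. matched M u"
    and pp[rule_format]: "\<forall>u v. plus_plus_edge E pref M u v \<longrightarrow> u \<in> R \<and> v \<in> R"
    and mm[rule_format]:
      "\<forall>u\<in>L. \<forall>v\<in>L. {u, v} \<in> E \<longrightarrow> minus_minus_edge E pref M u v"
    unfolding strongly_dominant_def by (elim exE conjE) (rule that)
  define \<alpha> :: "'a \<Rightarrow> real"
    where "\<alpha> u = (if u \<in> R then 1 else if matched M u then - 1 else 0)" for u
  have "(\<Sum>u\<in>e. \<alpha> u) = 0" if e: "e \<in> M" for e
  proof -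
    obtain u v where uv: "u \<in> L" "v \<in> R" "e = {u, v}" using M[OF e] by blast
    \<comment> \<open>The endpoint in \<open>L\<close> is matched by \<open>e\<close> itself, so its
      value is -1 and not 0, which cancels the 1 of the endpoint in \<open>R\<close>.\<close>
    then have "u \<notin> R" "u \<noteq> v" "matched M u"
      using disj e unfolding matched_def by auto
    with uv show ?thesis by (simp add: \<alpha>_def)
  qed
  moreover have "(\<Sum>u\<in>V. \<alpha> u) = (\<Sum>e\<in>M. \<Sum>u\<in>e. \<alpha> u)"
    using assms(1,3) by (rule sum_over_matching) (auto simp: \<alpha>_def dest: R)
  ultimately have "(\<Sum>u\<in>V. \<alpha> u) = 0" by simp
  moreover have "\<alpha> u + \<alpha> v \<ge> wt E pref M u v" if e: "{u, v} \<in> E" for u v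
  proof -
    have "u \<in> L \<union> R" "v \<in> L \<union> R" "u \<noteq> v"
      using simple_graph_edgeD[OF assms(1) e] V by auto
    \<comment> \<open>A (+,+) edge has both endpoints in \<open>R\<close>, giving 1 + 1 = 2. An edge
      inside \<open>L\<close> has weight -2, the least possible sum. Any other edge has weight at
      most 0 and an endpoint of value 1, while the other value is at least -1.\<close>
    then show ?thesis
      using pp[of u v] mm[of u v] e by (auto simp: wt_def \<alpha>_def)
  qed
  moreover have "\<forall>u\<in>V. \<alpha> u \<ge> wt E pref M u u"
    by (auto simp: wt_def \<alpha>_def)
  moreover have "\<forall>u\<in>V. matched M u \<longrightarrow> \<alpha> u \<in> {1, - 1}"
    by (simp add: \<alpha>_def)
  moreover have "\<forall>u\<in>V. \<not> matched M u \<longrightarrow> \<alpha> u = 0"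
    using R by (auto simp: \<alpha>_def)
  ultimately show "\<exists>\<alpha> :: 'a \<Rightarrow> real.
       (\<Sum>u\<in>V. \<alpha> u) = 0 \<and>
       (\<forall>u v. {u, v} \<in> E \<longrightarrow> \<alpha> u + \<alpha> v \<ge> wt E pref M u v) \<and>
       (\<forall>u\<in>V. \<alpha> u \<ge> wt E pref M u u) \<and>
       (\<forall>u\<in>V. matched M u \<longrightarrow> \<alpha> u \<in> {1, - 1}) \<and>
       (\<forall>u\<in>V. \<not> matched M u \<longrightarrow> \<alpha> u = 0)"
    by blast
next
  assume "\<exists>\<alpha> :: 'a \<Rightarrow> real.
       (\<Sum>u\<in>V. \<alpha> u) = 0 \<and>
       (\<forall>u v. {u, v} \<in> E \<longrightarrow> \<alpha> u + \<alpha> v \<ge> wt E pref M u v) \<and>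
       (\<forall>u\<in>V. \<alpha> u \<ge> wt E pref M u u) \<and>
       (\<forall>u\<in>V. matched M u \<longrightarrow> \<alpha> u \<in> {1, - 1}) \<and>
       (\<forall>u\<in>V. \<not> matched M u \<longrightarrow> \<alpha> u = 0)"
  then obtain \<alpha> :: "'a \<Rightarrow> real" where sum0: "(\<Sum>u\<in>V. \<alpha> u) = 0"
    and cover: "\<And>u v. {u, v} \<in> E \<Longrightarrow> \<alpha> u + \<alpha> v \<ge> wt E pref M u v"
    and mat: "\<And>u. u \<in> V \<Longrightarrow> matched M u \<Longrightarrow> \<alpha> u = 1 \<or> \<alpha> u = - 1"
    and unm: "\<And>u. u \<in> V \<Longrightarrow> \<not> matched M u \<Longrightarrow> \<alpha> u = 0"
    by auto
  note edgeD = simple_graph_edgeD[OF assms(1)]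
  have ME: "M \<subseteq> E" using assms(3) by (simp add: matching_def)
  have "finite V" "E \<subseteq> Pow V" using assms(1) by (auto simp: simple_graph_def)
  with ME have finM: "finite M" by (meson finite_Pow_iff finite_subset)
  \<comment> \<open>This is the covering inequality at an edge of \<open>M\<close>, whose weight is
    0.\<close>
  have nonneg: "(\<Sum>u\<in>e. \<alpha> u) \<ge> 0" if e: "e \<in> M" for e
  proof -
    obtain u v where "e = {u, v}" "u \<noteq> v"
      using simple_graph_edgeE[OF assms(1)] ME e by blast
    then show ?thesis
      using cover[of u v] ME e wt_matching_edge[of u v M E pref] by auto
  qed
  have "(\<Sum>e\<in>M. \<Sum>u\<in>e. \<alpha> u) = 0"
    using sum_over_matching[OF assms(1,3), of \<alpha>] unm sum0 by simp
  with nonneg finM have tight: "(\<Sum>u\<in>e. \<alpha> u) = 0" if "e \<in> M" for e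
    using that by (subst (asm) sum_nonneg_eq_0_iff) auto
  \<comment> \<open>The complement \<open>V - R\<close> thus collects the matched nodes of value -1
    and all unmatched nodes.\<close>
  define R where "R = {u\<in>V. \<alpha> u = 1}"
  have "\<exists>u\<in>V - R. \<exists>v\<in>R. e = {u, v}" if e: "e \<in> M" for e
  proof -
    obtain u v where uv: "e = {u, v}" "u \<noteq> v"
      using simple_graph_edgeE[OF assms(1)] ME e by blast
    have "{u, v} \<in> E" "matched M u" "matched M v"
      using uv(1) e ME unfolding matched_def by (blast, blast, metis insert_commute)
    moreover from this have V: "u \<in> V" "v \<in> V" using edgeD by blast+
    ultimately have "\<alpha> u = 1 \<and> \<alpha> v = - 1 \<or> \<alpha> u = - 1 \<and> \<alpha> v = 1"
      using tight[OF e] mat[of u] mat[of v] uv by auto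
    then show ?thesis
    proof
      assume "\<alpha> u = 1 \<and> \<alpha> v = - 1"
      with V have "v \<in> V - R" "u \<in> R" by (simp_all add: R_def)
      moreover have "e = {v, u}" using uv(1) by (simp add: insert_commute)
      ultimately show ?thesis by blast
    next
      assume "\<alpha> u = - 1 \<and> \<alpha> v = 1"
      with V have "u \<in> V - R" "v \<in> R" by (simp_all add: R_def)
      with uv(1) show ?thesis by blast
    qed
  qed
  moreover have "matched M u" if "u \<in> R" for u
    using that unm unfolding R_def by force
  moreover have "u \<in> R \<and> v \<in> R" if pp: "plus_plus_edge E pref M u v" for u v
  proof -
    have e: "{u, v} \<in> E" using pp by (simp add: plus_plus_edge_def)
    then have V: "u \<in> V" "v \<in> V" "u \<noteq> v" using edgeD by blast+
    \<comment> \<open>No value exceeds 1, so weight 2 can be covered only by 1 + 1.\<close>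
    then have "\<alpha> u + \<alpha> v \<ge> 2" using cover[OF e] pp by (simp add: wt_def)
    moreover have "\<alpha> u \<le> 1" "\<alpha> v \<le> 1" using V mat unm by fastforce+
    ultimately show ?thesis using V by (simp add: R_def)
  qed
  moreover have "minus_minus_edge E pref M u v"
    if L: "u \<in> V - R" "v \<in> V - R" and e: "{u, v} \<in> E" for u v
  proof (rule ccontr)
    assume "\<not> minus_minus_edge E pref M u v"
    then have "wt E pref M u v \<ge> 0" using edgeD(3)[OF e] by (simp add: wt_def)
    then have "\<alpha> u + \<alpha> v \<ge> 0" using cover[OF e] by linarith
    \<comment> \<open>Outside \<open>R\<close> no value is positive, so a nonnegative sum forces
      both values to be 0 and both nodes to be unmatched.\<close>
    moreover have "\<not> matched M u \<and> \<alpha> u = 0 \<or> \<alpha> u = - 1"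
      "\<not> matched M v \<and> \<alpha> v = 0 \<or> \<alpha> v = - 1"
      using L mat unm unfolding R_def by blast+
    ultimately have un: "\<not> matched M u" "\<not> matched M v" and "\<alpha> u + \<alpha> v = 0" by auto
    \<comment> \<open>Unmatched nodes put the label + on every edge outside \<open>M\<close>, and
      this edge is not in \<open>M\<close>. Its weight is therefore 2, which the sum 0 fails to
      cover.\<close>
    moreover from un e have "plus_plus_edge E pref M u v"
      by (auto simp: plus_plus_edge_def plus_label_def matched_def)
    ultimately show False
      using cover[OF e] edgeD(3)[OF e] by (simp add: wt_def)
  qed
  moreover have "V - R \<union> R = V" "(V - R) \<inter> R = {}" by (auto simp: R_def)
  ultimately show "strongly_dominant V E pref M"
    unfolding strongly_dominant_def by (intro exI[of _ "V - R"] exI[of _ R] conjI) simp_all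
qed

end
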